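(* Let $X$ be a compact and connected topological manifold, equipped with a metric $d$ inducing its topology, and let $f:X\to X$ be a continuous map. If $f$ is locally eventually onto and positively expansive, then $(X,f)$ has the periodic specification property.
   Context: Let $(X,d)$ be a compact metric space and $f:X\to X$ a continuous map; $(X,f)$ is called a (topological) dynamical system. $\mathbb N=\{0,1,2,\dots\}$. Locally eventually onto: for every nonempty open set $U\subset X$ there is $n\in\mathbb N$ with $f^n(U)=X$. Positively expansive (called simply "expansive"): there exists $\alpha>0$ such that if $x,y\in X$ and $x\neq y$, then $d(f^n(x),f^n(y))>\alpha$ for some $n\ge 0$. Specification: for integers $b\ge a\ge 0$ let $f^{[a,b]}(x):=\{f^j(x): a\le j\le b\}$. A family of orbit segments $\{f^{[a_j,b_j]}(x_j)\}_{j=1}^n$ (with $x_j\in X$ and integers $0\le a_j\le b_j$) is an $N$-spaced specification if $a_i-b_{i-1}\ge N$ for $2\le i\le n$. It is $\varepsilon$-shadowed by $y\in X$ if $d(f^k(y),f^k(x_i))\le\varepsilon$ for all $a_i\le k\le b_i$ and $1\le i\le n$. The system $(X,f)$ has the specification property if for any $\varepsilon>0$ there is a constant $N=N(\varepsilon)$ such that any $N$-spaced specification $\{f^{[a_j,b_j]}(x_j)\}_{j=1}^n$ is $\varepsilon$-shadowed by some $y\in X$. If additionally $y$ can be chosen in such a way that $f^{b_n-a_1+N}(y)=y$, then $(X,f)$ has the periodic specification property. *)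

theory Defs
  imports "HOL-Analysis.Analysis"
begin

text \<open>Topological manifolds are without boundary; the dimension may be \<open>0\<close>.\<close>

definition topological_manifold :: "nat \<Rightarrow> 'a topology \<Rightarrow> bool" where
  "topological_manifold m T \<longleftrightarrow>
     Hausdorff_space T \<and> second_countable T \<and>
     (\<forall>x\<in>topspace T. \<exists>U V. openin T U \<and> x \<in> U \<and> openin (Euclidean_space m) V \<and>
        subtopology T U homeomorphic_space subtopology (Euclidean_space m) V)"

definition locally_eventually_onto :: "'a::metric_space set \<Rightarrow> ('a \<Rightarrow> 'a) \<Rightarrow> bool" where
  "locally_eventually_onto X f \<longleftrightarrow>
     (\<forall>U. openin (top_of_set X) U \<and> U \<noteq> {} \<longrightarrow> (\<exists>n. (f ^^ n) ` U = X))"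

definition positively_expansive :: "'a::metric_space set \<Rightarrow> ('a \<Rightarrow> 'a) \<Rightarrow> bool" where
  "positively_expansive X f \<longleftrightarrow>
     (\<exists>\<alpha>>0. \<forall>x\<in>X. \<forall>y\<in>X. x \<noteq> y \<longrightarrow> (\<exists>n. dist ((f ^^ n) x) ((f ^^ n) y) > \<alpha>))"

text \<open>
  A family of \<open>n\<close> orbit segments is given by functions \<open>x\<close>, \<open>a\<close>, \<open>b\<close> of which only the
  values on \<open>{1..n}\<close> matter. The gap condition \<open>a i - b (i - 1) \<ge> N\<close> is stated additively
  because subtraction on \<open>nat\<close> truncates.
\<close>

definition spaced_specification ::
  "'a set \<Rightarrow> nat \<Rightarrow> nat \<Rightarrow> (nat \<Rightarrow> 'a) \<Rightarrow> (nat \<Rightarrow> nat) \<Rightarrow> (nat \<Rightarrow> nat) \<Rightarrow> bool" where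
  "spaced_specification X N n x a b \<longleftrightarrow>
     n \<ge> 1 \<and> (\<forall>i\<in>{1..n}. x i \<in> X \<and> a i \<le> b i) \<and> (\<forall>i\<in>{2..n}. b (i - 1) + N \<le> a i)"

definition shadows ::
  "('a::metric_space \<Rightarrow> 'a) \<Rightarrow> real \<Rightarrow> nat \<Rightarrow> (nat \<Rightarrow> 'a) \<Rightarrow> (nat \<Rightarrow> nat) \<Rightarrow> (nat \<Rightarrow> nat) \<Rightarrow> 'a \<Rightarrow> bool"
where
  "shadows f \<epsilon> n x a b y \<longleftrightarrow>
     (\<forall>i\<in>{1..n}. \<forall>k\<in>{a i..b i}. dist ((f ^^ k) y) ((f ^^ k) (x i)) \<le> \<epsilon>)"

text \<open>
  The subtraction in the period never truncates: \<open>a 1 \<le> b n\<close> for every spaced specification.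
\<close>

definition periodic_specification_property :: "'a::metric_space set \<Rightarrow> ('a \<Rightarrow> 'a) \<Rightarrow> bool" where
  "periodic_specification_property X f \<longleftrightarrow>
     (\<forall>\<epsilon>>0. \<exists>N. \<forall>n x a b. spaced_specification X N n x a b \<longrightarrow>
        (\<exists>y\<in>X. shadows f \<epsilon> n x a b y \<and> (f ^^ (b n - a 1 + N)) y = y))"

end

theory Submission
  imports Defs "HOL-Homology.Invariance_of_Domain"
begin

text \<open>
  A positively expansive map is locally injective, so by invariance of domain it is open. For an
  open expansive map on a compact space, orbit segments of any length lift: if \<open>z\<close> is close to
  \<open>f\<^sup>n x\<close>, then \<open>z = f\<^sup>n y\<close> for some \<open>y\<close> whose orbit stays close to that of \<open>x\<close> up to time \<open>n\<close>.
  Since the map is locally eventually onto, the gaps of a sufficiently spaced specification can be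
  bridged backwards in time, and one obtains a point that shadows the specification and returns
  close to itself. Lifting repeatedly along its orbit closes this pseudo-periodic orbit up.
\<close>

section \<open>Locally injective maps between manifolds\<close>

text \<open>Read in charts around a point and its image, \<open>f\<close> is locally a continuous
  injection from an open subset of a Euclidean space into a Euclidean space of the same dimension
  \<open>m\<close>, so invariance of domain makes small images open.\<close>

lemma open_map_locally_injective_manifold:
  assumes T: "topological_manifold m T" and T': "topological_manifold m T'"
    and f: "continuous_map T T' f"
    and inj: "\<And>x. x \<in> topspace T \<Longrightarrow> \<exists>U. openin T U \<and> x \<in> U \<and> inj_on f U"
  shows "open_map T T' f"
  unfolding open_map_def
proof (intro allI impI)
  fix U assume U: "openin T U"
  show "openin T' (f ` U)"
  proof (subst openin_subopen, intro ballI)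
    fix y assume "y \<in> f ` U"
    then obtain x where x: "x \<in> U" "y = f x" by blast
    then have xT: "x \<in> topspace T" and yT: "y \<in> topspace T'"
      using U f openin_subset by (auto simp: continuous_map_def)
    obtain I where I: "openin T I" "x \<in> I" "inj_on f I" using inj[OF xT] by blast
    obtain A B h h' where A: "openin T A" "x \<in> A" "openin (Euclidean_space m) B"
      and h: "homeomorphic_maps (subtopology T A) (subtopology (Euclidean_space m) B) h h'"
      using T xT unfolding topological_manifold_def homeomorphic_space_def by meson
    obtain C D g g' where C: "openin T' C" "y \<in> C" "openin (Euclidean_space m) D"
      and g: "homeomorphic_maps (subtopology T' C) (subtopology (Euclidean_space m) D) g g'"
      using T' yT unfolding topological_manifold_def homeomorphic_space_def by meson
    define W where "W = U \<inter> I \<inter> A \<inter> {x \<in> topspace T. f x \<in> C}"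
    have W: "openin T W"
      unfolding W_def using U I A C f by (intro openin_Int openin_continuous_map_preimage) auto
    have WA: "W \<subseteq> A" and fW: "f ` W \<subseteq> C" and xW: "x \<in> W"
      using x xT I A C by (auto simp: W_def)
    have AT: "topspace (subtopology T A) = A" and CT: "topspace (subtopology T' C) = C"
      using A C openin_subset by fastforce+
    have hm: "homeomorphic_map (subtopology T A) (subtopology (Euclidean_space m) B) h"
      and gm: "homeomorphic_map (subtopology T' C) (subtopology (Euclidean_space m) D) g"
      using h g homeomorphic_maps_map by blast+
    have h'h: "h' (h w) = w" if "w \<in> W" for w
      using that h AT WA by (auto simp: homeomorphic_maps_def)
    have hW: "openin (Euclidean_space m) (h ` W)"
      using homeomorphic_map_openness[OF hm, of W] W A WA AT openin_open_subtopology
      by metis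
    have hWB: "h ` W \<subseteq> B"
      using homeomorphic_imp_surjective_map[OF hm] WA AT by auto
    let ?F = "\<lambda>v. g (f (h' v))"
    have "continuous_map (subtopology (Euclidean_space m) (h ` W)) T h'"
      using h hWB continuous_map_from_subtopology_mono continuous_map_into_fulltopology
      unfolding homeomorphic_maps_def by metis
    then have "continuous_map (subtopology (Euclidean_space m) (h ` W)) T' (f \<circ> h')"
      using f continuous_map_compose by blast
    moreover have "f (h' (h w)) \<in> C" if "w \<in> W" for w
      using that h'h fW by auto
    then have "f \<circ> h' \<in> topspace (subtopology (Euclidean_space m) (h ` W)) \<rightarrow> C"
      by auto
    ultimately have "continuous_map (subtopology (Euclidean_space m) (h ` W)) (subtopology T' C) (f \<circ> h')"
      by (rule continuous_map_into_subtopology)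
    then have "continuous_map (subtopology (Euclidean_space m) (h ` W)) (Euclidean_space m) (g \<circ> (f \<circ> h'))"
      using g continuous_map_compose continuous_map_into_fulltopology
      unfolding homeomorphic_maps_def by metis
    moreover have "inj_on (g \<circ> (f \<circ> h')) (h ` W)"
    proof (rule inj_onI)
      fix u v assume uv: "u \<in> h ` W" "v \<in> h ` W" "(g \<circ> (f \<circ> h')) u = (g \<circ> (f \<circ> h')) v"
      then obtain p q where pq: "p \<in> W" "q \<in> W" "u = h p" "v = h q" by blast
      then have "g (f p) = g (f q)" using uv h'h by auto
      then have "f p = f q"
        using homeomorphic_imp_injective_map[OF gm] pq fW unfolding CT by (meson image_subset_iff inj_onD)
      then show "u = v" using pq I(3) by (auto simp: inj_on_def W_def)
    qed
    ultimately have "openin (Euclidean_space m) ((g \<circ> (f \<circ> h')) ` (h ` W))"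
      using invariance_of_domain_Euclidean_space hW by blast
    moreover have "(g \<circ> (f \<circ> h')) ` (h ` W) = g ` (f ` W)"
      using h'h by (auto simp: image_iff)
    ultimately have "openin (Euclidean_space m) (g ` (f ` W))" by simp
    \<comment> \<open>Openness now moves back from Euclidean space to \<open>T'\<close> through the
      homeomorphism \<open>g\<close>.\<close>
    moreover have "g ` (f ` W) \<subseteq> D"
      using homeomorphic_imp_surjective_map[OF gm] fW CT by auto
    ultimately have "openin T' (f ` W)"
      using homeomorphic_map_openness[OF gm, of "f ` W"] C CT fW openin_open_subtopology
      by metis
    moreover have "y \<in> f ` W" "f ` W \<subseteq> f ` U" using xW x by (auto simp: W_def)
    ultimately show "\<exists>V. openin T' V \<and> y \<in> V \<and> V \<subseteq> f ` U" by blast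
  qed
qed

section \<open>Open expansive maps\<close>

text \<open>Openness is assumed outright, since it is what the dynamical argument takes from the
  manifold structure. Expansivity is stated contrapositively, with its constant fixed.\<close>

locale open_expansive_map =
  fixes X :: "'a::metric_space set" and f :: "'a \<Rightarrow> 'a" and \<alpha> :: real
  assumes compact: "compact X"
    and cont: "continuous_on X f"
    and maps: "f ` X \<subseteq> X"
    and opn: "open_map (top_of_set X) (top_of_set X) f"
    and pos: "\<alpha> > 0"
    and expansive: "\<lbrakk>x \<in> X; y \<in> X; \<And>n. dist ((f ^^ n) x) ((f ^^ n) y) \<le> \<alpha>\<rbrakk> \<Longrightarrow> x = y"
begin

lemma iter_in [simp]: "x \<in> X \<Longrightarrow> (f ^^ n) x \<in> X"
  using maps by (induction n) auto

lemma f_in [simp]: "x \<in> X \<Longrightarrow> f x \<in> X"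
  using maps by auto

lemma continuous_on_iter: "continuous_on X (f ^^ n)"
proof (induction n)
  case (Suc n)
  have "continuous_on ((f ^^ n) ` X) f"
    using cont by (rule continuous_on_subset) auto
  then show ?case using Suc continuous_on_compose by fastforce
qed (simp add: id_def)

lemma iter_iter: "(f ^^ m) ((f ^^ n) x) = (f ^^ (m + n)) x"
  by (simp add: funpow_add)

lemma tendsto_iter:
  assumes "u \<longlonglongrightarrow> l" "l \<in> X" "\<And>k. u k \<in> X"
  shows "(\<lambda>k. (f ^^ n) (u k)) \<longlonglongrightarrow> (f ^^ n) l"
  using continuous_on_tendsto_compose[OF continuous_on_iter assms(1,2)] assms(3) by simp

lemma convergent_subseq:
  assumes "\<And>k. u k \<in> X"
  obtains l and r :: "nat \<Rightarrow> nat" where "l \<in> X" "strict_mono r" "(\<lambda>k. u (r k)) \<longlonglongrightarrow> l"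
  using compact assms unfolding compact_def comp_def by metis

text \<open>Compactness: counterexamples for every \<open>K\<close> would accumulate at a pair of
  points at distance at least \<open>\<epsilon>\<close> whose orbits never separate by more than
  \<open>\<alpha>\<close>.\<close>

lemma uniform_expansivity:
  assumes "\<epsilon> > 0"
  shows "\<exists>K. \<forall>x\<in>X. \<forall>y\<in>X. (\<forall>j<K. dist ((f ^^ j) x) ((f ^^ j) y) \<le> \<alpha>) \<longrightarrow> dist x y < \<epsilon>"
proof (rule ccontr)
  assume "\<not> ?thesis"
  then have "\<forall>K. \<exists>x y. x \<in> X \<and> y \<in> X \<and> (\<forall>j<K. dist ((f ^^ j) x) ((f ^^ j) y) \<le> \<alpha>) \<and> \<epsilon> \<le> dist x y"
    by (metis linorder_not_less)
  then obtain x y where xy: "\<And>K. x K \<in> X" "\<And>K. y K \<in> X"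
      "\<And>K j. j < K \<Longrightarrow> dist ((f ^^ j) (x K)) ((f ^^ j) (y K)) \<le> \<alpha>" "\<And>K. \<epsilon> \<le> dist (x K) (y K)"
    by metis
  obtain p r where p: "p \<in> X" "strict_mono r" "(\<lambda>k. x (r k)) \<longlonglongrightarrow> p"
    using convergent_subseq[of x] xy by metis
  obtain q s where q: "q \<in> X" "strict_mono s" "(\<lambda>k. y (r (s k))) \<longlonglongrightarrow> q"
    using convergent_subseq[of "\<lambda>k. y (r k)"] xy by metis
  define t where "t = (\<lambda>k. r (s k))"
  have t: "strict_mono t" using p(2) q(2) by (simp add: t_def strict_mono_def)
  have xp: "(\<lambda>k. x (t k)) \<longlonglongrightarrow> p"
    using LIMSEQ_subseq_LIMSEQ[OF p(3) q(2)] by (simp add: t_def comp_def)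
  have yq: "(\<lambda>k. y (t k)) \<longlonglongrightarrow> q" using q by (simp add: t_def)
  have "dist ((f ^^ j) p) ((f ^^ j) q) \<le> \<alpha>" for j
  proof (rule tendsto_upperbound)
    show "(\<lambda>k. dist ((f ^^ j) (x (t k))) ((f ^^ j) (y (t k)))) \<longlonglongrightarrow> dist ((f ^^ j) p) ((f ^^ j) q)"
      using p q xy by (intro tendsto_dist tendsto_iter xp yq) auto
    \<comment> \<open>A fixed time \<open>j\<close> is covered as soon as \<open>j < k\<close>,
      because \<open>k \<le> t k\<close>.\<close>
    have "dist ((f ^^ j) (x (t k))) ((f ^^ j) (y (t k))) \<le> \<alpha>" if "k > j" for k
      using xy(3)[of j "t k"] seq_suble[OF t, of k] that by simp
    then show "\<forall>\<^sub>F k in sequentially. dist ((f ^^ j) (x (t k))) ((f ^^ j) (y (t k))) \<le> \<alpha>"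
      by (auto intro: eventually_mono[OF eventually_gt_at_top[of j]])
  qed simp
  then have "p = q" using expansive p(1) q(1) by blast
  moreover have "\<epsilon> \<le> dist p q"
    by (rule tendsto_lowerbound[OF tendsto_dist[OF xp yq]]) (auto simp: xy)
  ultimately show False using assms by simp
qed

section \<open>Lifting of orbit segments\<close>

text \<open>Counterexamples for shrinking \<open>\<delta>\<close> would have base points
  accumulating at some \<open>p\<close> and targets tending to \<open>f p\<close>. Openness at
  \<open>p\<close> then supplies preimages of the late targets near \<open>p\<close>, hence near the
  base points.\<close>

lemma uniformly_open:
  assumes "\<epsilon> > 0"
  shows "\<exists>\<delta>>0. \<forall>x\<in>X. \<forall>z\<in>X. dist (f x) z < \<delta> \<longrightarrow> (\<exists>y\<in>X. f y = z \<and> dist x y < \<epsilon>)"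
proof (rule ccontr)
  assume neg: "\<not> ?thesis"
  have "\<exists>x z. x \<in> X \<and> z \<in> X \<and> dist (f x) z < inverse (real (Suc k)) \<and> \<not> (\<exists>y\<in>X. f y = z \<and> dist x y < \<epsilon>)" for k
    using neg inverse_positive_iff_positive[of "real (Suc k)"] by (metis of_nat_0_less_iff zero_less_Suc)
  then obtain x z where xz: "\<And>k. x k \<in> X" "\<And>k. z k \<in> X"
      "\<And>k. dist (f (x k)) (z k) < inverse (real (Suc k))"
      "\<And>k y. y \<in> X \<Longrightarrow> f y = z k \<Longrightarrow> \<not> dist (x k) y < \<epsilon>"
    by metis
  obtain p r where p: "p \<in> X" "strict_mono r" "(\<lambda>k. x (r k)) \<longlonglongrightarrow> p"
    using convergent_subseq[of x] xz by metis
  have fx: "(\<lambda>k. f (x (r k))) \<longlonglongrightarrow> f p"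
    using tendsto_iter[OF p(3,1), of 1] xz by simp
  have "(\<lambda>k. dist (f (x k)) (z k)) \<longlonglongrightarrow> 0"
    by (rule real_tendsto_sandwich[OF _ _ tendsto_const LIMSEQ_inverse_real_of_nat])
       (use xz(3) in \<open>auto intro!: always_eventually less_imp_le\<close>)
  then have "(\<lambda>k. dist (f (x (r k))) (z (r k))) \<longlonglongrightarrow> 0"
    using LIMSEQ_subseq_LIMSEQ[OF _ p(2)] by (auto simp: comp_def)
  then have sum0: "(\<lambda>k. dist (f (x (r k))) (z (r k)) + dist (f (x (r k))) (f p)) \<longlonglongrightarrow> 0"
    using fx tendsto_add_zero by (auto simp: tendsto_dist_iff[of _ "f p"])
  have zp: "(\<lambda>k. z (r k)) \<longlonglongrightarrow> f p"
    unfolding tendsto_dist_iff[of _ "f p"]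
    by (rule real_tendsto_sandwich[OF _ _ tendsto_const sum0])
       (auto intro!: always_eventually dist_triangle3)
  \<comment> \<open>Half of \<open>\<epsilon>\<close> is kept for the distance from
    \<open>x (r k)\<close> to the limit \<open>p\<close>.\<close>
  have "openin (top_of_set X) (f ` (X \<inter> ball p (\<epsilon>/2)))"
    using opn unfolding open_map_def by (meson open_ball openin_open_Int)
  then obtain S where S: "open S" "f ` (X \<inter> ball p (\<epsilon>/2)) = X \<inter> S"
    by (auto simp: openin_open)
  have "f p \<in> S" using S(2) p(1) assms by auto
  then have "\<forall>\<^sub>F k in sequentially. z (r k) \<in> S"
    using zp S(1) topological_tendstoD by blast
  moreover have "\<forall>\<^sub>F k in sequentially. dist (x (r k)) p < \<epsilon>/2"
    using p(3) assms by (intro tendstoD) auto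
  ultimately have "\<forall>\<^sub>F k in sequentially. z (r k) \<in> S \<and> dist (x (r k)) p < \<epsilon>/2"
    by (rule eventually_conj)
  then obtain k where k: "z (r k) \<in> S" "dist (x (r k)) p < \<epsilon>/2"
    using eventually_happens by fastforce
  then obtain y where y: "y \<in> X" "dist p y < \<epsilon>/2" "f y = z (r k)"
  proof -
    have "z (r k) \<in> f ` (X \<inter> ball p (\<epsilon>/2))" using k(1) xz(2) S(2) by simp
    then show thesis using that by auto
  qed
  then have "dist (x (r k)) y < \<epsilon>"
    using k dist_triangle[of "x (r k)" y p] by simp
  then show False using xz(4) y by blast
qed

text \<open>The last step is lifted first and the rest by induction. Here \<open>\<delta>\<close>
  may shrink with \<open>K\<close>; this bounded version starts the induction that removes the
  dependence.\<close>

lemma bounded_lifting: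
  assumes "\<epsilon> > 0"
  shows "\<exists>\<delta>>0. \<forall>n\<le>K. \<forall>x\<in>X. \<forall>z\<in>X. dist ((f ^^ n) x) z < \<delta> \<longrightarrow>
           (\<exists>y\<in>X. (f ^^ n) y = z \<and> (\<forall>j\<le>n. dist ((f ^^ j) x) ((f ^^ j) y) < \<epsilon>))"
proof (induction K)
  case 0
  then show ?case using assms by auto
next
  case (Suc K)
  then obtain \<delta> where \<delta>: "\<delta> > 0" "\<And>n x z. n \<le> K \<Longrightarrow> x \<in> X \<Longrightarrow> z \<in> X \<Longrightarrow> dist ((f ^^ n) x) z < \<delta> \<Longrightarrow>
           \<exists>y\<in>X. (f ^^ n) y = z \<and> (\<forall>j\<le>n. dist ((f ^^ j) x) ((f ^^ j) y) < \<epsilon>)"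
    by blast
  obtain \<eta> where \<eta>: "\<eta> > 0" "\<And>x z. x \<in> X \<Longrightarrow> z \<in> X \<Longrightarrow> dist (f x) z < \<eta> \<Longrightarrow>
           \<exists>y\<in>X. f y = z \<and> dist x y < \<delta>"
    using uniformly_open[OF \<delta>(1)] by blast
  \<comment> \<open>\<open>\<eta>\<close> permits lifting the last step, and
    \<open>\<epsilon>\<close> gives closeness at the end time \<open>n\<close>, where the lift
    arrives at \<open>z\<close>.\<close>
  define \<theta> where "\<theta> = Min {\<delta>, \<eta>, \<epsilon>}"
  have \<theta>: "\<theta> > 0" "\<theta> \<le> \<delta>" "\<theta> \<le> \<eta>" "\<theta> \<le> \<epsilon>" using \<delta>(1) \<eta>(1) assms by (auto simp: \<theta>_def)
  have lift: "\<exists>y\<in>X. (f ^^ n) y = z \<and> (\<forall>j\<le>n. dist ((f ^^ j) x) ((f ^^ j) y) < \<epsilon>)"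
    if n: "n \<le> Suc K" and xz: "x \<in> X" "z \<in> X" "dist ((f ^^ n) x) z < \<theta>" for n x z
  proof (cases n)
    case 0
    then show ?thesis using xz \<theta> by auto
  next
    case (Suc n')
    obtain w where w: "w \<in> X" "f w = z" "dist ((f ^^ n') x) w < \<delta>"
      using \<eta>(2)[of "(f ^^ n') x" z] xz \<theta> Suc by auto
    then obtain y where "y \<in> X" "(f ^^ n') y = w" "\<forall>j\<le>n'. dist ((f ^^ j) x) ((f ^^ j) y) < \<epsilon>"
      using \<delta>(2)[of n' x w] xz n Suc by auto
    then show ?thesis using w xz \<theta> Suc by (auto simp: le_Suc_eq)
  qed
  show ?case by (intro exI[of _ \<theta>] conjI allI ballI impI \<theta>(1) lift)
qed

text \<open>
  The bound \<open>\<delta>\<close> does not depend on \<open>n\<close>: a lift that has stayed \<open>\<alpha>\<close>-close for \<open>K\<close> steps is, by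
  uniform expansivity, already close enough to the orbit of \<open>x\<close> to be lifted once more.
\<close>
lemma lifting:
  assumes "\<epsilon> > 0"
  obtains \<delta> where "\<delta> > 0" and "\<And>n x z. \<lbrakk>x \<in> X; z \<in> X; dist ((f ^^ n) x) z < \<delta>\<rbrakk> \<Longrightarrow>
           \<exists>y\<in>X. (f ^^ n) y = z \<and> (\<forall>j\<le>n. dist ((f ^^ j) x) ((f ^^ j) y) < \<epsilon>)"
proof -
  \<comment> \<open>Lifts are kept \<open>\<alpha>\<close>-close so that uniform expansivity applies
    to them.\<close>
  define \<eta> where "\<eta> = min \<epsilon> \<alpha>"
  have \<eta>: "\<eta> > 0" "\<eta> \<le> \<epsilon>" "\<eta> \<le> \<alpha>" using assms pos by (auto simp: \<eta>_def)
  obtain \<theta> where \<theta>: "\<theta> > 0" "\<And>x z. x \<in> X \<Longrightarrow> z \<in> X \<Longrightarrow> dist (f x) z < \<theta> \<Longrightarrow> \<exists>y\<in>X. f y = z \<and> dist x y < \<eta>"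
    using uniformly_open[OF \<eta>(1)] by blast
  obtain K where K: "\<And>x y. x \<in> X \<Longrightarrow> y \<in> X \<Longrightarrow> (\<And>j. j < K \<Longrightarrow> dist ((f ^^ j) x) ((f ^^ j) y) \<le> \<alpha>) \<Longrightarrow> dist x y < \<theta>"
    using uniform_expansivity[OF \<theta>(1)] by blast
  obtain \<delta> where \<delta>: "\<delta> > 0" "\<And>n x z. n \<le> K \<Longrightarrow> x \<in> X \<Longrightarrow> z \<in> X \<Longrightarrow> dist ((f ^^ n) x) z < \<delta> \<Longrightarrow>
           \<exists>y\<in>X. (f ^^ n) y = z \<and> (\<forall>j\<le>n. dist ((f ^^ j) x) ((f ^^ j) y) < \<eta>)"
    using bounded_lifting[OF \<eta>(1), of K] by blast
  have lift: "\<exists>y\<in>X. (f ^^ n) y = z \<and> (\<forall>j\<le>n. dist ((f ^^ j) x) ((f ^^ j) y) < \<eta>)"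
    if "x \<in> X" "z \<in> X" "dist ((f ^^ n) x) z < \<delta>" for n x z
    using that
  proof (induction n arbitrary: x)
    case 0
    then show ?case using \<delta>(2)[of 0] by simp
  next
    case (Suc n)
    show ?case
    proof (cases "Suc n \<le> K")
      case True
      then show ?thesis using \<delta>(2) Suc.prems by blast
    next
      case False
      \<comment> \<open>Unlike in the bounded case, the orbit of \<open>f x\<close> is lifted first.
        As \<open>K \<le> n\<close>, its lift \<open>w\<close> stays close for all times below
        \<open>K\<close>, hence is \<open>\<theta>\<close>-close to \<open>f x\<close> and has a
        preimage near \<open>x\<close>.\<close>
      have "(f ^^ n) (f x) = (f ^^ Suc n) x" by (simp add: funpow_swap1)
      then obtain w where w: "w \<in> X" "(f ^^ n) w = z" "\<forall>j\<le>n. dist ((f ^^ j) (f x)) ((f ^^ j) w) < \<eta>"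
        using Suc.IH[of "f x"] Suc.prems by auto
      have "dist (f x) w < \<theta>"
      proof (rule K)
        fix j assume "j < K"
        then show "dist ((f ^^ j) (f x)) ((f ^^ j) w) \<le> \<alpha>"
          using w(3) False \<eta>(3) by (meson less_imp_le order.strict_trans2 not_less_eq_eq order_trans)
      qed (use w Suc.prems in auto)
      then obtain y where y: "y \<in> X" "f y = w" "dist x y < \<eta>"
        using \<theta>(2)[of x w] w Suc.prems by auto
      have "dist ((f ^^ j) x) ((f ^^ j) y) < \<eta>" if "j \<le> Suc n" for j
        using that w(3) y by (cases j) (auto simp: funpow_swap1)
      moreover have "(f ^^ Suc n) y = z" using y w by (simp add: funpow_swap1)
      ultimately show ?thesis using y(1) by blast
    qed
  qed
  show thesis
  proof (rule that[OF \<delta>(1)])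
    fix n x z assume "x \<in> X" "z \<in> X" "dist ((f ^^ n) x) z < \<delta>"
    from lift[OF this] obtain y where y: "y \<in> X" "(f ^^ n) y = z"
      and close: "\<forall>j\<le>n. dist ((f ^^ j) x) ((f ^^ j) y) < \<eta>" by blast
    have "\<forall>j\<le>n. dist ((f ^^ j) x) ((f ^^ j) y) < \<epsilon>" using close \<eta>(2) by fastforce
    then show "\<exists>y\<in>X. (f ^^ n) y = z \<and> (\<forall>j\<le>n. dist ((f ^^ j) x) ((f ^^ j) y) < \<epsilon>)"
      using y by blast
  qed
qed

section \<open>Closing of pseudo-periodic orbits\<close>

text \<open>Lifting along the orbit segment of \<open>v\<close> takes points near \<open>v\<close>
  to points near \<open>v\<close>, so it can be repeated forever. A limit of the successive lifts
  follows the periodic repetition of this segment, and expansivity makes it periodic.\<close>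

lemma closing:
  assumes "\<epsilon> > 0"
  obtains \<delta> K where "\<delta> > 0"
    and "\<And>v P. \<lbrakk>v \<in> X; K \<le> P; dist ((f ^^ P) v) v < \<delta>\<rbrakk> \<Longrightarrow>
           \<exists>p\<in>X. (f ^^ P) p = p \<and> (\<forall>j\<le>P. dist ((f ^^ j) v) ((f ^^ j) p) \<le> \<epsilon>)"
proof -
  \<comment> \<open>With \<open>\<alpha>/2\<close>, two points that \<open>\<eta>\<close>-follow the
    same sequence stay \<open>\<alpha>\<close>-close and therefore coincide.\<close>
  define \<eta> where "\<eta> = min \<epsilon> (\<alpha>/2)"
  have \<eta>: "\<eta> > 0" "\<eta> \<le> \<epsilon>" "2 * \<eta> \<le> \<alpha>" "\<eta> \<le> \<alpha>" using assms pos by (auto simp: \<eta>_def)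
  obtain \<delta> where \<delta>: "\<delta> > 0" and lift: "\<And>n x z. \<lbrakk>x \<in> X; z \<in> X; dist ((f ^^ n) x) z < \<delta>\<rbrakk> \<Longrightarrow>
           \<exists>y\<in>X. (f ^^ n) y = z \<and> (\<forall>j\<le>n. dist ((f ^^ j) x) ((f ^^ j) y) < \<eta>)"
    using lifting[OF \<eta>(1)] by blast
  obtain K where K: "\<And>x y. x \<in> X \<Longrightarrow> y \<in> X \<Longrightarrow> (\<And>j. j < K \<Longrightarrow> dist ((f ^^ j) x) ((f ^^ j) y) \<le> \<alpha>) \<Longrightarrow> dist x y < \<delta>/2"
    using uniform_expansivity[of "\<delta>/2"] \<delta> by (meson half_gt_zero)
  \<comment> \<open>\<open>Suc K\<close> also ensures \<open>P > 0\<close>, as the reductions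
    \<open>j mod P\<close> require. The return error and the distance of a target from
    \<open>v\<close> each take half of \<open>\<delta>\<close>.\<close>
  have "\<exists>p\<in>X. (f ^^ P) p = p \<and> (\<forall>j\<le>P. dist ((f ^^ j) v) ((f ^^ j) p) \<le> \<epsilon>)"
    if v: "v \<in> X" "Suc K \<le> P" "dist ((f ^^ P) v) v < \<delta>/2" for v P
  proof -
    let ?good = "\<lambda>z. z \<in> X \<and> dist v z < \<delta>/2"
    let ?lift = "\<lambda>z y. (f ^^ P) y = z \<and> (\<forall>j\<le>P. dist ((f ^^ j) v) ((f ^^ j) y) < \<eta>)"
    \<comment> \<open>A lift stays close for \<open>P > K\<close> steps, so uniform expansivity
      returns it to the \<open>\<delta>/2\<close>-ball around \<open>v\<close>.\<close>
    have "\<exists>y. ?good y \<and> ?lift z y" if z: "?good z" for z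
    proof -
      have "dist ((f ^^ P) v) z < \<delta>"
        using z v(3) dist_triangle[of "(f ^^ P) v" z v] by simp
      then obtain y where y: "y \<in> X" "?lift z y" using lift[of v z P] v z by blast
      have "dist v y < \<delta>/2"
      proof (rule K)
        fix j assume "j < K"
        then have "dist ((f ^^ j) v) ((f ^^ j) y) < \<eta>" using y v(2) by auto
        then show "dist ((f ^^ j) v) ((f ^^ j) y) \<le> \<alpha>" using \<eta>(4) by simp
      qed (use v y in auto)
      then show ?thesis using y by blast
    qed
    then have "\<exists>z. \<forall>k. ?good (z k) \<and> ?lift (z k) (z (Suc k))"
      using v \<delta> by (intro dependent_nat_choice) (auto intro!: exI[of _ v])
    then obtain z where z: "\<And>k. z k \<in> X" "\<And>k. (f ^^ P) (z (Suc k)) = z k"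
        "\<And>k j. j \<le> P \<Longrightarrow> dist ((f ^^ j) v) ((f ^^ j) (z (Suc k))) < \<eta>"
      by blast
    have pulled_back: "(f ^^ (i * P)) (z (i + k)) = z k" for i k
    proof (induction i arbitrary: k)
      case (Suc i)
      have "(f ^^ (Suc i * P)) (z (Suc i + k)) = (f ^^ P) ((f ^^ (i * P)) (z (i + Suc k)))"
        by (simp add: iter_iter)
      then show ?case by (simp only: Suc z(2))
    qed simp
    \<comment> \<open>Applying \<open>f\<close> for \<open>j div P\<close> full periods takes
      \<open>z k\<close> to some \<open>z (Suc l)\<close>. The strict inequality keeps this index
      positive, so that point is a lift and follows \<open>v\<close>.\<close>
    have track: "dist ((f ^^ (j mod P)) v) ((f ^^ j) (z k)) \<le> \<eta>" if k: "k > j div P" for j k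
    proof -
      obtain l where l: "k = j div P + Suc l" using less_imp_Suc_add[OF k] by auto
      have "(f ^^ j) (z k) = (f ^^ (j mod P + (j div P) * P)) (z k)" by simp
      also have "\<dots> = (f ^^ (j mod P)) (z (Suc l))"
        unfolding funpow_add comp_def l pulled_back ..
      finally show ?thesis using z(3)[of "j mod P" l] v(2) by (simp add: less_imp_le)
    qed
    obtain p r where p: "p \<in> X" "strict_mono r" "(\<lambda>k. z (r k)) \<longlonglongrightarrow> p"
      using convergent_subseq[of z] z by metis
    have trackp: "dist ((f ^^ (j mod P)) v) ((f ^^ j) p) \<le> \<eta>" for j
    proof (rule tendsto_upperbound)
      show "(\<lambda>k. dist ((f ^^ (j mod P)) v) ((f ^^ j) (z (r k)))) \<longlonglongrightarrow> dist ((f ^^ (j mod P)) v) ((f ^^ j) p)"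
        using p z by (intro tendsto_dist tendsto_iter tendsto_const) auto
      have "dist ((f ^^ (j mod P)) v) ((f ^^ j) (z (r k))) \<le> \<eta>" if "k > j div P" for k
        using track[of j "r k"] seq_suble[OF p(2), of k] that by simp
      then show "\<forall>\<^sub>F k in sequentially. dist ((f ^^ (j mod P)) v) ((f ^^ j) (z (r k))) \<le> \<eta>"
        by (auto intro: eventually_mono[OF eventually_gt_at_top[of "j div P"]])
    qed simp
    \<comment> \<open>Both \<open>p\<close> and \<open>(f ^^ P) p\<close> follow the same
      \<open>P\<close>-periodic sequence.\<close>
    have per: "(f ^^ P) p = p"
    proof (rule expansive)
      fix j
      have "dist ((f ^^ (j mod P)) v) ((f ^^ j) ((f ^^ P) p)) \<le> \<eta>"
        using trackp[of "j + P"] by (simp add: funpow_add)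
      then show "dist ((f ^^ j) ((f ^^ P) p)) ((f ^^ j) p) \<le> \<alpha>"
        using trackp[of j] \<eta>(3) dist_triangle3[of "(f ^^ j) ((f ^^ P) p)" "(f ^^ j) p" "(f ^^ (j mod P)) v"]
        by linarith
    qed (use p in auto)
    have "dist ((f ^^ j) v) ((f ^^ j) p) \<le> \<eta>" if "j \<le> P" for j
    proof (cases "j = P")
      case True
      \<comment> \<open>At time \<open>P\<close> the residue is \<open>0\<close>, so
        \<open>trackp\<close> compares with \<open>v\<close> instead of \<open>(f ^^ P) v\<close>;
        the limit is taken anew from the lifts.\<close>
      have "dist ((f ^^ P) v) ((f ^^ P) (z (Suc (r k)))) \<le> \<eta>" for k
        using z(3)[of P "r k"] by simp
      then have "dist ((f ^^ P) v) (z (r k)) \<le> \<eta>" for k by (simp add: z(2))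
      then have "dist ((f ^^ P) v) p \<le> \<eta>"
        by (intro tendsto_upperbound[OF tendsto_dist[OF tendsto_const p(3)]]) auto
      then show ?thesis using per True by simp
    next
      case False
      then show ?thesis using trackp[of j] that by simp
    qed
    then have "\<forall>j\<le>P. dist ((f ^^ j) v) ((f ^^ j) p) \<le> \<epsilon>" using \<eta>(2) by fastforce
    then show ?thesis using per p(1) by blast
  qed
  then show thesis using that[of "\<delta>/2" "Suc K"] \<delta> by auto
qed

section \<open>Specification\<close>

context
  assumes leo: "locally_eventually_onto X f" and surj: "f ` X = X"
begin

lemma iter_surj: "(f ^^ n) ` X = X"
proof (induction n)
  case (Suc n)
  have "(f ^^ Suc n) ` X = f ` ((f ^^ n) ` X)" by (simp add: image_image)
  then show ?case using Suc surj by simp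
qed simp

text \<open>A finite cover by balls of radius \<open>\<delta>/2\<close> leaves finitely many waiting
  times, and surjectivity keeps an image that fills \<open>X\<close> full at all later
  times.\<close>

lemma uniformly_eventually_onto:
  assumes "\<delta> > 0"
  obtains M where "\<And>x n. x \<in> X \<Longrightarrow> M \<le> n \<Longrightarrow> (f ^^ n) ` (X \<inter> ball x \<delta>) = X"
proof -
  have "X \<subseteq> (\<Union>c\<in>X. ball c (\<delta>/2))" using assms by force
  then obtain C where C: "finite C" "C \<subseteq> X" "X \<subseteq> (\<Union>c\<in>C. ball c (\<delta>/2))"
    using compactE_image[OF compact, of X "\<lambda>c. ball c (\<delta>/2)"] open_ball by metis
  have "\<exists>n. (f ^^ n) ` (X \<inter> ball c (\<delta>/2)) = X" if "c \<in> C" for c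
  proof -
    have "openin (top_of_set X) (X \<inter> ball c (\<delta>/2))" by (simp add: openin_open_Int)
    moreover have "X \<inter> ball c (\<delta>/2) \<noteq> {}" using that C(2) assms by auto
    ultimately show ?thesis using leo unfolding locally_eventually_onto_def by blast
  qed
  then obtain N where N: "\<And>c. c \<in> C \<Longrightarrow> (f ^^ N c) ` (X \<inter> ball c (\<delta>/2)) = X" by metis
  show thesis
  proof (rule that)
    \<comment> \<open>The sum serves as a common upper bound of the waiting times, also when
      \<open>C\<close> is empty.\<close>
    fix x n assume x: "x \<in> X" and n: "(\<Sum>c\<in>C. N c) \<le> n"
    obtain c where c: "c \<in> C" "dist c x < \<delta>/2" using C(3) x by auto
    then have "N c \<le> n" using n member_le_sum[of c C N] C(1) by simp
    then have "X = (f ^^ (n - N c)) ` (f ^^ N c) ` (X \<inter> ball c (\<delta>/2))"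
      using N[OF c(1)] iter_surj by simp
    also have "\<dots> = (f ^^ n) ` (X \<inter> ball c (\<delta>/2))"
      using \<open>N c \<le> n\<close> by (simp add: image_comp flip: funpow_add)
    also have "\<dots> \<subseteq> (f ^^ n) ` (X \<inter> ball x \<delta>)"
    proof (intro image_mono Int_mono subsetI)
      fix y assume "y \<in> ball c (\<delta>/2)"
      then show "y \<in> ball x \<delta>" using c(2) dist_triangle3[of x y c] by simp
    qed simp
    finally show "(f ^^ n) ` (X \<inter> ball x \<delta>) = X" by auto
  qed
qed

text \<open>The free target \<open>t\<close> drives the induction on the number of segments: a point
  shadowing the last segment becomes the target for the earlier ones. Later the target makes the
  orbit return. Time is shifted so that \<open>w\<close> starts at time \<open>a 1\<close>.\<close>

lemma shadowing_with_target:
  assumes "\<epsilon> > 0"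
  obtains N where "\<And>n x a b g t. \<lbrakk>spaced_specification X N n x a b; N \<le> g; t \<in> X\<rbrakk> \<Longrightarrow>
      a 1 \<le> b n \<and> (\<forall>i\<in>{1..n}. a 1 \<le> a i \<and> b i \<le> b n) \<and>
      (\<exists>w\<in>X. (f ^^ (b n - a 1 + g)) w = t \<and>
        (\<forall>i\<in>{1..n}. \<forall>k\<in>{a i..b i}. dist ((f ^^ k) (x i)) ((f ^^ (k - a 1)) w) < \<epsilon>))"
proof -
  obtain \<delta> where \<delta>: "\<delta> > 0" and lift: "\<And>n x z. \<lbrakk>x \<in> X; z \<in> X; dist ((f ^^ n) x) z < \<delta>\<rbrakk> \<Longrightarrow>
           \<exists>y\<in>X. (f ^^ n) y = z \<and> (\<forall>j\<le>n. dist ((f ^^ j) x) ((f ^^ j) y) < \<epsilon>)"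
    using lifting[OF assms] by blast
  obtain N where N: "\<And>x n. x \<in> X \<Longrightarrow> N \<le> n \<Longrightarrow> (f ^^ n) ` (X \<inter> ball x \<delta>) = X"
    using uniformly_eventually_onto[OF \<delta>] by blast
  have single: "\<exists>w\<in>X. (f ^^ (b - a + g)) w = t \<and> (\<forall>k\<in>{a..b}. dist ((f ^^ k) x) ((f ^^ (k - a)) w) < \<epsilon>)"
    if xt: "x \<in> X" "t \<in> X" "a \<le> b" "N \<le> g" for x t a b g
  proof -
    have ab: "(f ^^ (b - a)) ((f ^^ a) x) = (f ^^ b) x"
      using that(3) by (simp add: iter_iter)
    \<comment> \<open>The gap is bridged backwards: some \<open>u\<close> near the end of the
      segment reaches \<open>t\<close> after \<open>g\<close> steps, and \<open>u\<close> is then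
      lifted along the segment.\<close>
    have "t \<in> (f ^^ g) ` (X \<inter> ball ((f ^^ b) x) \<delta>)" using N that by simp
    then obtain u where u: "u \<in> X" "dist ((f ^^ b) x) u < \<delta>" "(f ^^ g) u = t" by auto
    then obtain w where w: "w \<in> X" "(f ^^ (b - a)) w = u"
        "\<forall>j\<le>b - a. dist ((f ^^ j) ((f ^^ a) x)) ((f ^^ j) w) < \<epsilon>"
      using lift[of "(f ^^ a) x" u "b - a"] xt ab by auto
    have "(f ^^ (b - a + g)) w = t" using w u by (metis add.commute iter_iter)
    moreover have "dist ((f ^^ k) x) ((f ^^ (k - a)) w) < \<epsilon>" if "k \<in> {a..b}" for k
    proof -
      have "(f ^^ k) x = (f ^^ (k - a)) ((f ^^ a) x)"
        using that by (simp add: iter_iter)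
      then show ?thesis using w(3) that by auto
    qed
    ultimately show ?thesis using w(1) by blast
  qed
  show thesis
  proof (rule that)
    fix n x a b g t
    assume "spaced_specification X N n x a b" "N \<le> g" "t \<in> X"
    then show "a 1 \<le> b n \<and> (\<forall>i\<in>{1..n}. a 1 \<le> a i \<and> b i \<le> b n) \<and>
      (\<exists>w\<in>X. (f ^^ (b n - a 1 + g)) w = t \<and>
        (\<forall>i\<in>{1..n}. \<forall>k\<in>{a i..b i}. dist ((f ^^ k) (x i)) ((f ^^ (k - a 1)) w) < \<epsilon>))"
    proof (induction n arbitrary: g t)
      case 0
      then show ?case by (simp add: spaced_specification_def)
    next
      case (Suc n)
      have last: "x (Suc n) \<in> X" "a (Suc n) \<le> b (Suc n)"
        using Suc.prems(1) by (auto simp: spaced_specification_def)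
      show ?case
      proof (cases "n = 0")
        case True
        then show ?thesis using single[of "x 1" t "a 1" "b 1" g] last Suc.prems by auto
      next
        case False
        then have "Suc n \<in> {2..Suc n}" by auto
        then have "b (Suc n - 1) + N \<le> a (Suc n)"
          using Suc.prems(1) unfolding spaced_specification_def by blast
        then have gap: "b n + N \<le> a (Suc n)" by simp
        have spec: "spaced_specification X N n x a b"
          using Suc.prems(1) False by (auto simp: spaced_specification_def)
        obtain w' where w': "w' \<in> X" "(f ^^ (b (Suc n) - a (Suc n) + g)) w' = t"
            "\<forall>k\<in>{a (Suc n)..b (Suc n)}. dist ((f ^^ k) (x (Suc n))) ((f ^^ (k - a (Suc n))) w') < \<epsilon>"
          using single[OF last(1) Suc.prems(3) last(2) Suc.prems(2)] by blast
        \<comment> \<open>The gap before the last segment is the waiting time \<open>g\<close> in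
          the induction hypothesis, with target \<open>w'\<close>.\<close>
        have "N \<le> a (Suc n) - b n" using gap by simp
        from Suc.IH[OF spec this w'(1)] obtain w where ord: "a 1 \<le> b n" "\<forall>i\<in>{1..n}. a 1 \<le> a i \<and> b i \<le> b n"
          and w: "w \<in> X" "(f ^^ (b n - a 1 + (a (Suc n) - b n))) w = w'"
            "\<forall>i\<in>{1..n}. \<forall>k\<in>{a i..b i}. dist ((f ^^ k) (x i)) ((f ^^ (k - a 1)) w) < \<epsilon>"
          by blast
        have ww': "(f ^^ (a (Suc n) - a 1)) w = w'" using w(2) ord(1) gap by simp
        have later: "(f ^^ (k - a 1)) w = (f ^^ (k - a (Suc n))) w'" if "a (Suc n) \<le> k" for k
        proof -
          have "k - a 1 = (k - a (Suc n)) + (a (Suc n) - a 1)" using that ord(1) gap by simp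
          then show ?thesis by (simp only: funpow_add comp_apply ww')
        qed
        have "(f ^^ (b (Suc n) - a 1 + g)) w = t"
          using later[of "b (Suc n) + g"] last ord(1) gap w'(2) by simp
        moreover have "dist ((f ^^ k) (x i)) ((f ^^ (k - a 1)) w) < \<epsilon>"
          if "i \<in> {1..Suc n}" "k \<in> {a i..b i}" for i k
          using that w(3) w'(3) later by (cases "i = Suc n") auto
        moreover have "a 1 \<le> a i \<and> b i \<le> b (Suc n)" if "i \<in> {1..Suc n}" for i
          using that ord gap last by (cases "i = Suc n") force+
        ultimately show ?thesis using w(1) ord(1) gap last by auto
      qed
    qed
  qed
qed

lemma periodic_specification: "periodic_specification_property X f"
  unfolding periodic_specification_property_def
proof (intro allI impI)
  fix \<epsilon> :: real assume \<epsilon>: "\<epsilon> > 0"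
  obtain \<delta> K where \<delta>: "\<delta> > 0" and close: "\<And>v P. \<lbrakk>v \<in> X; K \<le> P; dist ((f ^^ P) v) v < \<delta>\<rbrakk> \<Longrightarrow>
           \<exists>p\<in>X. (f ^^ P) p = p \<and> (\<forall>j\<le>P. dist ((f ^^ j) v) ((f ^^ j) p) \<le> \<epsilon>/2)"
    using closing[of "\<epsilon>/2"] \<epsilon> by (metis half_gt_zero)
  \<comment> \<open>\<open>\<delta>\<close> is for the return that \<open>closing\<close> needs;
    \<open>\<epsilon>/2\<close> leaves room for the distance from \<open>v\<close> to the periodic
    point.\<close>
  have m: "min \<delta> (\<epsilon>/2) > 0" using \<delta> \<epsilon> by simp
  obtain N where N: "\<And>n x a b g t. \<lbrakk>spaced_specification X N n x a b; N \<le> g; t \<in> X\<rbrakk> \<Longrightarrow>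
      a 1 \<le> b n \<and> (\<forall>i\<in>{1..n}. a 1 \<le> a i \<and> b i \<le> b n) \<and>
      (\<exists>w\<in>X. (f ^^ (b n - a 1 + g)) w = t \<and>
        (\<forall>i\<in>{1..n}. \<forall>k\<in>{a i..b i}. dist ((f ^^ k) (x i)) ((f ^^ (k - a 1)) w) < min \<delta> (\<epsilon>/2)))"
    using shadowing_with_target[OF m] by blast
  \<comment> \<open>\<open>L\<close> is at least \<open>N\<close> for the gaps and the return, at
    least \<open>K\<close> for \<open>closing\<close>, and positive, so that
    \<open>a 1 \<le> a 1 * P\<close>.\<close>
  define L where "L = Suc (N + K)"
  have "\<exists>y\<in>X. shadows f \<epsilon> n x a b y \<and> (f ^^ (b n - a 1 + L)) y = y"
    if L: "spaced_specification X L n x a b" for n x a b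
  proof -
    have "1 \<in> {1..n}" and first: "x 1 \<in> X" "a 1 \<le> b 1"
      using L by (auto simp: spaced_specification_def)
    have "spaced_specification X N n x a b"
      using L by (fastforce simp: spaced_specification_def L_def)
    \<comment> \<open>The target is the initial point of the first segment. Since \<open>v\<close>
      starts close to that point, it returns close to itself.\<close>
    from N[OF this, of L "(f ^^ a 1) (x 1)"] first
    obtain v where ord: "a 1 \<le> b n" "\<And>i. i \<in> {1..n} \<Longrightarrow> a 1 \<le> a i \<and> b i \<le> b n"
      and v: "v \<in> X" "(f ^^ (b n - a 1 + L)) v = (f ^^ a 1) (x 1)"
        "\<And>i k. i \<in> {1..n} \<Longrightarrow> k \<in> {a i..b i} \<Longrightarrow> dist ((f ^^ k) (x i)) ((f ^^ (k - a 1)) v) < min \<delta> (\<epsilon>/2)"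
      by (auto simp: L_def)
    define P where "P = b n - a 1 + L"
    have "dist ((f ^^ P) v) v < \<delta>"
      using v(2) v(3)[OF \<open>1 \<in> {1..n}\<close>, of "a 1"] first by (simp add: P_def)
    then obtain p where p: "p \<in> X" "(f ^^ P) p = p" "\<And>j. j \<le> P \<Longrightarrow> dist ((f ^^ j) v) ((f ^^ j) p) \<le> \<epsilon>/2"
      using close[of v P] v(1) by (auto simp: P_def L_def)
    have pk: "(f ^^ (k * P)) p = p" for k
      by (induction k) (auto simp: funpow_add p(2))
    \<comment> \<open>\<open>p\<close> belongs to time \<open>a 1\<close>, so it must be moved back
      by \<open>a 1\<close> steps. Periodicity allows this by going forward
      \<open>a 1 * P - a 1\<close> steps.\<close>
    define y where "y = (f ^^ (a 1 * P - a 1)) p"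
    have "a 1 \<le> a 1 * P" by (simp add: P_def L_def)
    then have ya: "(f ^^ a 1) y = p"
      using pk[of "a 1"] by (simp add: y_def iter_iter)
    have "(f ^^ P) y = y"
      unfolding y_def using p(2) by (metis add.commute iter_iter)
    moreover have "shadows f \<epsilon> n x a b y"
      unfolding shadows_def
    proof (intro ballI)
      fix i k assume i: "i \<in> {1..n}" and k: "k \<in> {a i..b i}"
      then have "a 1 \<le> k" "k - a 1 \<le> P" using ord(2)[OF i] by (auto simp: P_def)
      have "k = (k - a 1) + a 1" using \<open>a 1 \<le> k\<close> by simp
      then have "(f ^^ k) y = (f ^^ (k - a 1)) p" by (metis iter_iter ya)
      then show "dist ((f ^^ k) y) ((f ^^ k) (x i)) \<le> \<epsilon>"
        using v(3)[OF i k] p(3)[OF \<open>k - a 1 \<le> P\<close>]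
          dist_triangle2[of "(f ^^ k) (x i)" "(f ^^ k) y" "(f ^^ (k - a 1)) v"]
        by (simp add: dist_commute)
    qed
    moreover have "y \<in> X" using p(1) by (simp add: y_def)
    ultimately show ?thesis unfolding P_def by blast
  qed
  then show "\<exists>N. \<forall>n x a b. spaced_specification X N n x a b \<longrightarrow>
      (\<exists>y\<in>X. shadows f \<epsilon> n x a b y \<and> (f ^^ (b n - a 1 + N)) y = y)" by blast
qed

end

end

theorem theorem1:
  fixes X :: "'a::metric_space set" and f :: "'a \<Rightarrow> 'a" and m :: nat
  assumes "compact X"
    and "connected X"
    and "topological_manifold m (top_of_set X)"
    and "continuous_on X f"
    and "f ` X \<subseteq> X"
    and "locally_eventually_onto X f"
    and "positively_expansive X f"
  shows "periodic_specification_property X f"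
proof -
  obtain \<alpha> where \<alpha>: "\<alpha> > 0" "\<And>x y. x \<in> X \<Longrightarrow> y \<in> X \<Longrightarrow> (\<And>n. dist ((f ^^ n) x) ((f ^^ n) y) \<le> \<alpha>) \<Longrightarrow> x = y"
    using assms(7) unfolding positively_expansive_def by (metis linorder_not_less)
  have "\<exists>U. openin (top_of_set X) U \<and> x \<in> U \<and> inj_on f U" if x: "x \<in> X" for x
  \<comment> \<open>Points with equal images can differ only at time \<open>0\<close>, and in a ball
    of radius \<open>\<alpha>/2\<close> they are \<open>\<alpha>\<close>-close then as well.\<close>
  proof (intro exI[of _ "X \<inter> ball x (\<alpha>/2)"] conjI inj_onI)
    fix y z assume yz: "y \<in> X \<inter> ball x (\<alpha>/2)" "z \<in> X \<inter> ball x (\<alpha>/2)" "f y = f z"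
    show "y = z"
    proof (rule \<alpha>(2))
      fix n
      show "dist ((f ^^ n) y) ((f ^^ n) z) \<le> \<alpha>"
      proof (cases n)
        case 0
        then show ?thesis using yz dist_triangle3[of y z x] by simp
      next
        case (Suc n')
        then show ?thesis using yz \<alpha>(1) by (simp add: funpow_swap1)
      qed
    qed (use yz in auto)
  qed (use x \<alpha>(1) in \<open>auto simp: openin_open_Int\<close>)
  then have opn: "open_map (top_of_set X) (top_of_set X) f"
    using assms by (intro open_map_locally_injective_manifold[of m]) auto
  interpret open_expansive_map X f \<alpha>
    using assms opn \<alpha> by unfold_locales auto
  \<comment> \<open>Surjectivity comes from connectedness: the image is open because
    \<open>f\<close> is open, and closed because it is compact.\<close>
  have "openin (top_of_set X) (f ` X)"
    using opn unfolding open_map_def by (metis openin_topspace topspace_euclidean_subtopology)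
  moreover have "closedin (top_of_set X) (f ` X)"
    using assms by (intro closed_subset compact_imp_closed compact_continuous_image) auto
  ultimately have "X \<noteq> {} \<longrightarrow> f ` X = X"
    using assms(2) unfolding connected_clopen by blast
  then have "f ` X = X" by auto
  then show ?thesis using periodic_specification assms(6) by blast
qed

end
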